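(* Let $a_0,b_0>0$ and $a_i,b_j>0$ (for $i\in\mathcal{E}^X$, $j\in\mathcal{E}^Y$) be positive degrees. If $F(x,y)\in\mathbb{C}[x,y]_{a_0,b_0}$, $g_i\in\mathbb{C}[x]_{a_i}$ $(i\in\mathcal{E}^X)$, $h_j\in\mathbb{C}[y]_{b_j}$ $(j\in\mathcal{E}^Y)$ are generic polynomials, then the polynomial system $$\left\{\begin{array}{l} \nabla_xF(x,y)=\sum_{i\in\mathcal{E}^X}\lambda_i(x,y)\nabla_xg_i(x),\\ g_i(x)=0\ (i\in\mathcal{E}^X_1),\quad \lambda_i(x,y)g_i(x)=0\ (i\in\mathcal{E}^X_2),\\ \nabla_yF(x,y)=\sum_{j\in\mathcal{E}^Y}\mu_j(x,y)\nabla_yh_j(y),\\ h_j(y)=0\ (j\in\mathcal{E}^Y_1),\quad \mu_j(x,y)h_j(y)=0\ (j\in\mathcal{E}^Y_2) \end{array}\right.$$ has only finitely many complex solutions $(x,y)$ in $\mathbb{C}^n\times\mathbb{C}^m$.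
   Context: $x=(x_1,\dots,x_n)$, $y=(y_1,\dots,y_m)$. $\mathcal{E}^X=\mathcal{E}^X_1\sqcup\mathcal{E}^X_2=\{1,\dots,\ell_1\}$ and $\mathcal{E}^Y=\mathcal{E}^Y_1\sqcup\mathcal{E}^Y_2=\{1,\dots,\ell_2\}$ are finite label sets. $\mathbb{C}[x]_d$ is the space of complex polynomials in $x$ of degree at most $d$ (similarly $\mathbb{C}[y]_d$), and $\mathbb{C}[x,y]_{a_0,b_0}=\mathbb{C}[x]_{a_0}\cdot\mathbb{C}[y]_{b_0}$ is the space of polynomials in $(x,y)$ of degree at most $a_0$ in $x$ and at most $b_0$ in $y$. "Generic" means: the property holds for all coefficient vectors of $(F,g,h)$ in the corresponding coefficient space outside a subset of Lebesgue measure zero. Lagrange polynomials. Let $G(x)$ be the $(n+\ell_1)\times\ell_1$ matrix whose top $n$ rows are $[\nabla_xg_1(x),\dots,\nabla_xg_{\ell_1}(x)]$ and whose bottom $\ell_1$ rows are $\mathrm{diag}(g_1(x),\dots,g_{\ell_1}(x))$; define the $(m+\ell_2)\times\ell_2$ matrix $H(y)$ in the same way from $h_1,\dots,h_{\ell_2}$. The tuple $g=(g_1,\dots,g_{\ell_1})$ is nonsingular if $\mathrm{rank}\,G(x)=\ell_1$ for all $x\in\mathbb{C}^n$; $h=(h_1,\dots,h_{\ell_2})$ is nonsingular if $\mathrm{rank}\,H(y)=\ell_2$ for all $y\in\mathbb{C}^m$. Generic $g,h$ are nonsingular (known fact), and for nonsingular $g,h$ there exist matrix polynomials $G_1(x),H_1(y)$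 with $G_1G=I_{\ell_1}$, $H_1H=I_{\ell_2}$; fix such a choice. Then $\lambda(x,y)=G_1(x)_{:,1:n}\nabla_xF(x,y)$ and $\mu(x,y)=H_1(y)_{:,1:m}\nabla_yF(x,y)$, where $A_{:,1:n}$ denotes the first $n$ columns of $A$; $\lambda_i,\mu_j$ are their entries. *)

theory Defs
  imports
    "HOL-Analysis.Lebesgue_Measure"
    "HOL-Analysis.Finite_Product_Measure"
    "HOL-Library.Poly_Mapping"
    "Jordan_Normal_Form.DL_Rank"
begin

hide_const (open) Finite_Cartesian_Product.vec Finite_Cartesian_Product.vec_nth
unbundle no vec_syntax

text \<open>
  A polynomial with variables indexed by \<open>'v\<close> is a finitely supported map from exponent vectors
  to complex coefficients; the ring structure is that of \<^theory>\<open>HOL-Library.Poly_Mapping\<close>.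
  The variables \<open>x\<^sub>1, \<dots>, x\<^sub>n\<close> are the indices \<open>0, \<dots>, n - 1\<close>, and likewise for \<open>y\<close> and for all
  label sets. Polynomials in \<open>(x, y)\<close> have variables \<open>Inl i\<close> (for \<open>x\<close>) and \<open>Inr j\<close> (for \<open>y\<close>).
\<close>

type_synonym 'v mon = "'v \<Rightarrow>\<^sub>0 nat"
type_synonym 'v mpoly = "'v mon \<Rightarrow>\<^sub>0 complex"

definition peval :: "'v mpoly \<Rightarrow> ('v \<Rightarrow> complex) \<Rightarrow> complex" where
  "peval p v = (\<Sum>\<alpha>\<in>Poly_Mapping.keys p. Poly_Mapping.lookup p \<alpha> *
     (\<Prod>k\<in>Poly_Mapping.keys \<alpha>. v k ^ Poly_Mapping.lookup \<alpha> k))"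

text \<open>Formal partial derivative. Terms in which the variable \<open>k\<close> does not occur get the
  coefficient \<open>0\<close>, so the truncated subtraction of exponents is harmless.\<close>

definition pdiff :: "'v \<Rightarrow> 'v mpoly \<Rightarrow> 'v mpoly" where
  "pdiff k p = (\<Sum>\<alpha>\<in>Poly_Mapping.keys p.
     Poly_Mapping.single (\<alpha> - Poly_Mapping.single k 1)
       (of_nat (Poly_Mapping.lookup \<alpha> k) * Poly_Mapping.lookup p \<alpha>))"


definition monomials :: "nat \<Rightarrow> nat \<Rightarrow> nat mon set" where
  "monomials n d = {\<alpha>. Poly_Mapping.keys \<alpha> \<subseteq> {..<n} \<and> (\<Sum>k<n. Poly_Mapping.lookup \<alpha> k) \<le> d}"

definition monomials2 :: "nat \<Rightarrow> nat \<Rightarrow> nat \<Rightarrow> nat \<Rightarrow> (nat + nat) mon set" where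
  "monomials2 n m a0 b0 = {\<alpha>. Poly_Mapping.keys \<alpha> \<subseteq> Inl ` {..<n} \<union> Inr ` {..<m} \<and>
     (\<Sum>k<n. Poly_Mapping.lookup \<alpha> (Inl k)) \<le> a0 \<and> (\<Sum>k<m. Poly_Mapping.lookup \<alpha> (Inr k)) \<le> b0}"

lemma finite_bounded_mons:
  assumes "finite V"
  shows "finite {\<alpha> :: 'v mon. Poly_Mapping.keys \<alpha> \<subseteq> V \<and> (\<forall>k\<in>V. Poly_Mapping.lookup \<alpha> k \<le> d)}"
    (is "finite ?S")
proof (rule finite_imageD)
  show "finite (Poly_Mapping.lookup ` ?S)"
  proof (rule finite_subset)
    show "Poly_Mapping.lookup ` ?S
        \<subseteq> {f. \<forall>k. (k \<in> V \<longrightarrow> f k \<in> {..d}) \<and> (k \<notin> V \<longrightarrow> f k = 0)}"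
      by (auto simp: subset_iff in_keys_iff)
    show "finite {f :: 'v \<Rightarrow> nat. \<forall>k. (k \<in> V \<longrightarrow> f k \<in> {..d}) \<and> (k \<notin> V \<longrightarrow> f k = 0)}"
      using assms by (intro finite_set_of_finite_funs) auto
  qed
  show "inj_on Poly_Mapping.lookup ?S"
    by (simp add: inj_on_def poly_mapping_eqI)
qed

lemma finite_monomials: "finite (monomials n d)"
proof (rule finite_subset[OF _ finite_bounded_mons[of "{..<n}" d]])
  have "Poly_Mapping.lookup \<alpha> k \<le> (\<Sum>k<n. Poly_Mapping.lookup \<alpha> k)" if "k < n" for \<alpha> :: "nat mon" and k
    using that by (intro member_le_sum) auto
  then show "monomials n d \<subseteq>
      {\<alpha>. Poly_Mapping.keys \<alpha> \<subseteq> {..<n} \<and> (\<forall>k\<in>{..<n}. Poly_Mapping.lookup \<alpha> k \<le> d)}"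
    unfolding monomials_def by (auto intro: order_trans)
qed simp

lemma finite_monomials2: "finite (monomials2 n m a0 b0)"
proof (rule finite_subset[OF _ finite_bounded_mons[of "Inl ` {..<n} \<union> Inr ` {..<m}" "a0 + b0"]])
  have "Poly_Mapping.lookup \<alpha> (Inl k) \<le> a0 + b0"
    if "k < n" and "\<alpha> \<in> monomials2 n m a0 b0" for \<alpha> :: "(nat + nat) mon" and k
    using member_le_sum[of k "{..<n}" "\<lambda>k. Poly_Mapping.lookup \<alpha> (Inl k)"] that
    by (simp add: monomials2_def)
  moreover have "Poly_Mapping.lookup \<alpha> (Inr k) \<le> a0 + b0"
    if "k < m" and "\<alpha> \<in> monomials2 n m a0 b0" for \<alpha> :: "(nat + nat) mon" and k
    using member_le_sum[of k "{..<m}" "\<lambda>k. Poly_Mapping.lookup \<alpha> (Inr k)"] that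
    by (simp add: monomials2_def)
  ultimately show "monomials2 n m a0 b0 \<subseteq>
      {\<alpha>. Poly_Mapping.keys \<alpha> \<subseteq> Inl ` {..<n} \<union> Inr ` {..<m} \<and>
        (\<forall>k\<in>Inl ` {..<n} \<union> Inr ` {..<m}. Poly_Mapping.lookup \<alpha> k \<le> a0 + b0)}"
    by (intro subsetI CollectI conjI) (simp add: monomials2_def, auto)
qed auto

definition polys :: "nat \<Rightarrow> nat \<Rightarrow> nat mpoly set" where
  "polys n d = {p. Poly_Mapping.keys p \<subseteq> monomials n d}"

definition polys2 :: "nat \<Rightarrow> nat \<Rightarrow> nat \<Rightarrow> nat \<Rightarrow> (nat + nat) mpoly set" where
  "polys2 n m a0 b0 = {p. Poly_Mapping.keys p \<subseteq> monomials2 n m a0 b0}"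

definition poly_tuples :: "nat \<Rightarrow> nat \<Rightarrow> (nat \<Rightarrow> nat) \<Rightarrow> (nat \<Rightarrow> nat mpoly) set" where
  "poly_tuples n l d = (\<Pi>\<^sub>E i\<in>{..<l}. polys n (d i))"


text \<open>Index set of the joint coefficient vector of \<open>(F, g, h)\<close>.\<close>

datatype coeff_index =
    FCoeff "(nat + nat) mon"
  | GCoeff nat "nat mon"
  | HCoeff nat "nat mon"

definition coeff_indices ::
  "nat \<Rightarrow> nat \<Rightarrow> nat \<Rightarrow> nat \<Rightarrow> nat \<Rightarrow> nat \<Rightarrow> (nat \<Rightarrow> nat) \<Rightarrow> (nat \<Rightarrow> nat) \<Rightarrow> coeff_index set" where
  "coeff_indices n m l1 l2 a0 b0 a b =
     FCoeff ` monomials2 n m a0 b0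
     \<union> (\<Union>i<l1. GCoeff i ` monomials n (a i))
     \<union> (\<Union>j<l2. HCoeff j ` monomials m (b j))"

lemma finite_coeff_indices: "finite (coeff_indices n m l1 l2 a0 b0 a b)"
  by (simp add: coeff_indices_def finite_monomials finite_monomials2)

fun coeff_of :: "(nat + nat) mpoly \<Rightarrow> (nat \<Rightarrow> nat mpoly) \<Rightarrow> (nat \<Rightarrow> nat mpoly) \<Rightarrow> coeff_index \<Rightarrow> complex" where
  "coeff_of F g h (FCoeff \<alpha>) = Poly_Mapping.lookup F \<alpha>"
| "coeff_of F g h (GCoeff i \<alpha>) = Poly_Mapping.lookup (g i) \<alpha>"
| "coeff_of F g h (HCoeff j \<alpha>) = Poly_Mapping.lookup (h j) \<alpha>"

text \<open>A property of \<open>(F, g, h)\<close> is generic if it holds whenever the coefficient vector lies outside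
  some set of Lebesgue measure zero. Every Lebesgue null set is contained in a Borel null set, so
  it is enough to use null sets of the product of the Borel-Lebesgue measures on the
  (real two-dimensional) coordinates.\<close>

definition generically ::
  "nat \<Rightarrow> nat \<Rightarrow> nat \<Rightarrow> nat \<Rightarrow> nat \<Rightarrow> nat \<Rightarrow> (nat \<Rightarrow> nat) \<Rightarrow> (nat \<Rightarrow> nat) \<Rightarrow>
   ((nat + nat) mpoly \<Rightarrow> (nat \<Rightarrow> nat mpoly) \<Rightarrow> (nat \<Rightarrow> nat mpoly) \<Rightarrow> bool) \<Rightarrow> bool" where
  "generically n m l1 l2 a0 b0 a b P \<longleftrightarrow>
     (let I = coeff_indices n m l1 l2 a0 b0 a b in
      \<exists>N \<in> null_sets (Pi\<^sub>M I (\<lambda>_. lborel :: complex measure)).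
        \<forall>F \<in> polys2 n m a0 b0. \<forall>g \<in> poly_tuples n l1 a. \<forall>h \<in> poly_tuples m l2 b.
          restrict (coeff_of F g h) I \<notin> N \<longrightarrow> P F g h)"


text \<open>The matrix polynomial \<open>G\<close> of the tuple \<open>g\<^sub>0, \<dots>, g\<^bsub>l-1\<^esub>\<close>: gradients in the top \<open>n\<close> rows, the
  diagonal matrix of the \<open>g\<^sub>i\<close> below. The same construction applied to \<open>h\<close> gives \<open>H\<close>.\<close>

definition constraint_mat :: "nat \<Rightarrow> nat \<Rightarrow> (nat \<Rightarrow> nat mpoly) \<Rightarrow> nat mpoly mat" where
  "constraint_mat n l g = mat (n + l) l
     (\<lambda>(r, i). if r < n then pdiff r (g i) else if r = n + i then g i else 0)"

definition eval_mat :: "nat mpoly mat \<Rightarrow> complex vec \<Rightarrow> complex mat" where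
  "eval_mat A x = map_mat (\<lambda>p. peval p (\<lambda>k. x $ k)) A"

definition nonsingular_tuple :: "nat \<Rightarrow> nat \<Rightarrow> (nat \<Rightarrow> nat mpoly) \<Rightarrow> bool" where
  "nonsingular_tuple n l g \<longleftrightarrow>
     (\<forall>x \<in> carrier_vec n. vec_space.rank (n + l) (eval_mat (constraint_mat n l g) x) = l)"

definition poly_left_inverse :: "nat \<Rightarrow> nat \<Rightarrow> (nat \<Rightarrow> nat mpoly) \<Rightarrow> nat mpoly mat \<Rightarrow> bool" where
  "poly_left_inverse n l g L \<longleftrightarrow>
     L \<in> carrier_mat l (n + l) \<and> elements_mat L \<subseteq> (\<Union>d. polys n d) \<and>
     L * constraint_mat n l g = 1\<^sub>m l"

definition first_cols :: "nat \<Rightarrow> complex mat \<Rightarrow> complex mat" where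
  "first_cols n A = mat (dim_row A) n (\<lambda>(i, k). A $$ (i, k))"

definition grad :: "nat \<Rightarrow> nat mpoly \<Rightarrow> complex vec \<Rightarrow> complex vec" where
  "grad n p x = vec n (\<lambda>k. peval (pdiff k p) (\<lambda>k. x $ k))"

definition xgrad :: "nat \<Rightarrow> (nat + nat) mpoly \<Rightarrow> complex vec \<Rightarrow> complex vec \<Rightarrow> complex vec" where
  "xgrad n F x y = vec n (\<lambda>k. peval (pdiff (Inl k) F) (case_sum (\<lambda>k. x $ k) (\<lambda>k. y $ k)))"

definition ygrad :: "nat \<Rightarrow> (nat + nat) mpoly \<Rightarrow> complex vec \<Rightarrow> complex vec \<Rightarrow> complex vec" where
  "ygrad m F x y = vec m (\<lambda>k. peval (pdiff (Inr k) F) (case_sum (\<lambda>k. x $ k) (\<lambda>k. y $ k)))"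

definition lagrange_x ::
  "nat \<Rightarrow> nat mpoly mat \<Rightarrow> (nat + nat) mpoly \<Rightarrow> complex vec \<Rightarrow> complex vec \<Rightarrow> complex vec" where
  "lagrange_x n G1 F x y = first_cols n (eval_mat G1 x) *\<^sub>v xgrad n F x y"

definition lagrange_y ::
  "nat \<Rightarrow> nat mpoly mat \<Rightarrow> (nat + nat) mpoly \<Rightarrow> complex vec \<Rightarrow> complex vec \<Rightarrow> complex vec" where
  "lagrange_y m H1 F x y = first_cols m (eval_mat H1 y) *\<^sub>v ygrad m F x y"

definition kkt_solutions ::
  "nat \<Rightarrow> nat \<Rightarrow> nat set \<Rightarrow> nat set \<Rightarrow> nat set \<Rightarrow> nat set \<Rightarrow> nat mpoly mat \<Rightarrow> nat mpoly mat \<Rightarrow>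
   (nat + nat) mpoly \<Rightarrow> (nat \<Rightarrow> nat mpoly) \<Rightarrow> (nat \<Rightarrow> nat mpoly) \<Rightarrow> (complex vec \<times> complex vec) set" where
  "kkt_solutions n m EX1 EX2 EY1 EY2 G1 H1 F g h =
     {(x, y). x \<in> carrier_vec n \<and> y \<in> carrier_vec m \<and>
       (let lam = lagrange_x n G1 F x y; mu = lagrange_y m H1 F x y in
         xgrad n F x y = vec n (\<lambda>k. \<Sum>i\<in>EX1 \<union> EX2. lam $ i * grad n (g i) x $ k) \<and>
         (\<forall>i\<in>EX1. peval (g i) (\<lambda>k. x $ k) = 0) \<and>
         (\<forall>i\<in>EX2. lam $ i * peval (g i) (\<lambda>k. x $ k) = 0) \<and>
         ygrad m F x y = vec m (\<lambda>k. \<Sum>j\<in>EY1 \<union> EY2. mu $ j * grad m (h j) y $ k) \<and>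
         (\<forall>j\<in>EY1. peval (h j) (\<lambda>k. y $ k) = 0) \<and>
         (\<forall>j\<in>EY2. mu $ j * peval (h j) (\<lambda>k. y $ k) = 0))}"

end

theory Submission
  imports Defs
begin

text \<open>
  Fix the sets \<open>A\<close>, \<open>B\<close> of constraints that are active at a solution; the multipliers outside them
  vanish. The system in the unknowns \<open>(x, y, \<lambda>\<^sub>A, \<mu>\<^sub>B)\<close> is then square, and each equation contains
  one coefficient of \<open>(F, g, h)\<close> additively and in no other equation: a linear coefficient of \<open>F\<close> or
  the constant coefficient of an active \<open>g\<^sub>i\<close> or \<open>h\<^sub>j\<close>. Solving for these, the whole coefficient
  vector becomes a polynomial function of the unknowns and the remaining coefficients, as many
  variables as there are coefficients. Together with one coordinate of \<open>x\<close> or \<open>y\<close> this gives more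
  polynomials than variables, so they are algebraically dependent, by counting monomials. For
  coefficients outside the zero set of a nonzero polynomial, which is a null set by Fubini, the
  dependence is a nontrivial univariate equation for that coordinate.
\<close>

section \<open>Algebraic dependence by counting monomials\<close>

text \<open>Gaussian elimination: each step spends one row \<open>s0\<close> with a nonzero entry in
  column \<open>b\<close> to clear that column, so rows and columns shrink together and a row is
  left over.\<close>

lemma underdetermined_system:
  fixes M :: "'s \<Rightarrow> 'b \<Rightarrow> 'k :: field"
  assumes "finite B" "finite S" "card B < card S"
  shows "\<exists>c. (\<exists>s\<in>S. c s \<noteq> 0) \<and> (\<forall>b\<in>B. (\<Sum>s\<in>S. c s * M s b) = 0)"
  using assms
proof (induction B arbitrary: S M rule: finite_induct)
  case empty
  then have "S \<noteq> {}" by auto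
  then show ?case by (intro exI[of _ "\<lambda>_. 1"]) auto
next
  case (insert b B)
  show ?case
  proof (cases "\<forall>s\<in>S. M s b = 0")
    case True
    moreover have "\<exists>c. (\<exists>s\<in>S. c s \<noteq> 0) \<and> (\<forall>b\<in>B. (\<Sum>s\<in>S. c s * M s b) = 0)"
      using insert.prems insert.hyps by (intro insert.IH) simp_all
    ultimately show ?thesis by simp
  next
    case False
    then obtain s0 where s0: "s0 \<in> S" "M s0 b \<noteq> 0" by auto
    let ?S = "S - {s0}"
    have "card B < card ?S" "finite ?S"
      using insert.prems insert.hyps s0 by auto
    \<comment> \<open>The multiple of row \<open>s0\<close> that clears column \<open>b\<close> is
      subtracted from every other row; \<open>?t\<close> below collects these multiples as the
      coefficient of row \<open>s0\<close>.\<close>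
    from insert.IH[OF this(2) this(1), of "\<lambda>s b'. M s b' - M s b / M s0 b * M s0 b'"]
    obtain c where c: "\<exists>s\<in>?S. c s \<noteq> 0"
      and eq: "\<forall>b'\<in>B. (\<Sum>s\<in>?S. c s * (M s b' - M s b / M s0 b * M s0 b')) = 0"
      by blast
    let ?t = "- (\<Sum>s\<in>?S. c s * M s b) / M s0 b"
    let ?c = "c(s0 := ?t)"
    have sum: "(\<Sum>s\<in>S. ?c s * M s b') = ?t * M s0 b' + (\<Sum>s\<in>?S. c s * M s b')" for b'
      using s0 insert.prems by (simp add: sum.remove[of S s0])
    have "(\<Sum>s\<in>S. ?c s * M s b') = 0" if "b' \<in> B" for b'
    proof -
      have "0 = (\<Sum>s\<in>?S. c s * M s b' - (c s * M s b) * (M s0 b' / M s0 b))"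
        using bspec[OF eq that] by (simp add: algebra_simps)
      also have "\<dots> = (\<Sum>s\<in>?S. c s * M s b') + ?t * M s0 b'"
        by (simp add: sum_subtractf sum_distrib_right sum_divide_distrib)
      finally show ?thesis unfolding sum by (simp add: add.commute)
    qed
    moreover have "(\<Sum>s\<in>S. ?c s * M s b) = 0"
      unfolding sum using s0 by simp
    moreover have "\<exists>s\<in>S. ?c s \<noteq> 0" using c by auto
    ultimately show ?thesis by (intro exI[of _ ?c]) auto
  qed
qed

text \<open>The bound \<open>d\<close> applies to the exponent of each variable separately, so the
  admissible exponents form a box that is easy to count. Monomials may repeat in a derivation, which
  makes closure under addition immediate.\<close>

inductive poly_fun_le :: "'v set \<Rightarrow> nat \<Rightarrow> (('v \<Rightarrow> 'k::comm_ring_1) \<Rightarrow> 'k) \<Rightarrow> bool"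
  for V :: "'v set" and d :: nat
where
  zero: "poly_fun_le V d (\<lambda>_. 0)"
| add_monomial: "poly_fun_le V d f \<Longrightarrow> \<forall>k\<in>V. \<alpha> k \<le> d \<Longrightarrow>
    poly_fun_le V d (\<lambda>v. f v + c * (\<Prod>k\<in>V. v k ^ \<alpha> k))"

lemma poly_fun_le_mono: "poly_fun_le V d f \<Longrightarrow> d \<le> e \<Longrightarrow> poly_fun_le V e f"
  by (induction rule: poly_fun_le.induct) (auto intro!: poly_fun_le.intros dest: le_trans)

lemma poly_fun_le_add:
  assumes "poly_fun_le V d f" "poly_fun_le V d g"
  shows "poly_fun_le V d (\<lambda>v. f v + g v)"
  using assms(2)
proof (induction rule: poly_fun_le.induct)
  case zero
  then show ?case using assms(1) by simp
next
  case (add_monomial g \<alpha> c)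
  then show ?case
    using poly_fun_le.add_monomial[of V d "\<lambda>v. f v + g v" \<alpha> c] by (simp add: add.assoc)
qed

lemma poly_fun_le_mult_monomial:
  assumes "poly_fun_le V d f" "\<forall>k\<in>V. \<beta> k \<le> e"
  shows "poly_fun_le V (d + e) (\<lambda>v. f v * (c * (\<Prod>k\<in>V. v k ^ \<beta> k)))"
  using assms(1)
proof (induction rule: poly_fun_le.induct)
  case zero
  then show ?case by (simp add: poly_fun_le.zero)
next
  case (add_monomial f \<alpha> b)
  then have "\<forall>k\<in>V. \<alpha> k + \<beta> k \<le> d + e" using assms(2) by (auto intro: add_mono)
  from poly_fun_le.add_monomial[OF add_monomial.IH this, of "b * c"] show ?case
    by (simp add: power_add prod.distrib algebra_simps)
qed

lemma poly_fun_le_mult: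
  assumes "poly_fun_le V d f" "poly_fun_le V e g"
  shows "poly_fun_le V (d + e) (\<lambda>v. f v * g v)"
  using assms(2)
proof (induction rule: poly_fun_le.induct)
  case zero
  then show ?case by (simp add: poly_fun_le.zero)
next
  case (add_monomial g \<beta> c)
  from poly_fun_le_add[OF add_monomial.IH poly_fun_le_mult_monomial[OF assms(1) add_monomial.hyps(2), of c]]
  show ?case by (simp add: distrib_left)
qed

lemma poly_fun_le_const: "poly_fun_le V d (\<lambda>_. c)"
  using poly_fun_le.add_monomial[OF poly_fun_le.zero[of V d], of "\<lambda>_. 0" c] by simp

lemma poly_fun_le_power:
  "poly_fun_le V d f \<Longrightarrow> poly_fun_le V (d * n) (\<lambda>v. f v ^ n)"
proof (induction n)
  case (Suc n)
  from poly_fun_le_mult[OF Suc.prems Suc.IH[OF Suc.prems]] show ?case by simp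
qed (simp add: poly_fun_le_const)

lemma poly_fun_le_prod:
  assumes "finite W" "\<And>w. w \<in> W \<Longrightarrow> poly_fun_le V d (f w)"
  shows "poly_fun_le V (card W * d) (\<lambda>v. \<Prod>w\<in>W. f w v)"
  using assms
proof (induction W rule: finite_induct)
  case (insert w W)
  from poly_fun_le_mult[OF insert.prems insert.IH, of w] insert show ?case by simp
qed (simp add: poly_fun_le_const)

lemma poly_fun_le_var:
  fixes V :: "'v set"
  assumes "finite V" "q \<in> V"
  shows "poly_fun_le V 1 (\<lambda>v. v q :: 'k::comm_ring_1)"
proof -
  have "(\<Prod>k\<in>V. v k ^ (if k = q then 1 else 0)) = v q" for v :: "'v \<Rightarrow> 'k"
  proof -
    have "(\<Prod>k\<in>V. v k ^ (if k = q then 1 else 0)) = (\<Prod>k\<in>V. if k = q then v k else 1)"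
      by (intro prod.cong) auto
    then show ?thesis using assms by simp
  qed
  moreover have "\<forall>k\<in>V. (if k = q then 1 else 0) \<le> (1 :: nat)" by simp
  from poly_fun_le.add_monomial[OF poly_fun_le.zero this, of 1]
  have "poly_fun_le V 1 (\<lambda>v. \<Prod>k\<in>V. v k ^ (if k = q then 1 else 0) :: 'k)" by simp
  ultimately show ?thesis by (simp only:)
qed

text \<open>Collects repeated monomials. Exponents are cut down to \<open>V\<close>, so that each
  monomial has exactly one index in the box.\<close>

lemma poly_fun_le_coeffs:
  assumes "finite V" "poly_fun_le V d f"
  shows "\<exists>c. \<forall>v. f v = (\<Sum>\<alpha>\<in>V \<rightarrow>\<^sub>E {..d}. c \<alpha> * (\<Prod>k\<in>V. v k ^ \<alpha> k))"
  using assms(2)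
proof (induction rule: poly_fun_le.induct)
  case zero
  then show ?case by (intro exI[of _ "\<lambda>_. 0"]) simp
next
  case (add_monomial f \<alpha> b)
  then obtain c where c: "f v = (\<Sum>\<alpha>\<in>V \<rightarrow>\<^sub>E {..d}. c \<alpha> * (\<Prod>k\<in>V. v k ^ \<alpha> k))" for v
    by auto
  let ?\<alpha> = "restrict \<alpha> V"
  let ?c = "\<lambda>\<beta>. c \<beta> + (if \<beta> = ?\<alpha> then b else 0)"
  have fin: "finite (V \<rightarrow>\<^sub>E {..d})" using assms(1) by (simp add: finite_PiE)
  have mem: "?\<alpha> \<in> V \<rightarrow>\<^sub>E {..d}" using add_monomial by auto
  have "f v + b * (\<Prod>k\<in>V. v k ^ \<alpha> k) = (\<Sum>\<beta>\<in>V \<rightarrow>\<^sub>E {..d}. ?c \<beta> * (\<Prod>k\<in>V. v k ^ \<beta> k))" for v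
  proof -
    have "(\<Sum>\<beta>\<in>V \<rightarrow>\<^sub>E {..d}. (if \<beta> = ?\<alpha> then b else 0) * (\<Prod>k\<in>V. v k ^ \<beta> k))
        = (\<Sum>\<beta>\<in>V \<rightarrow>\<^sub>E {..d}. if \<beta> = ?\<alpha> then b * (\<Prod>k\<in>V. v k ^ \<beta> k) else 0)"
      by (intro sum.cong) auto
    also have "\<dots> = b * (\<Prod>k\<in>V. v k ^ ?\<alpha> k)" using fin mem by simp
    finally show ?thesis by (simp add: c distrib_right sum.distrib)
  qed
  then show ?case by (intro exI[of _ ?c]) simp
qed

text \<open>The products of the \<open>\<Psi> w\<close> with exponents at most \<open>d\<close>
  number \<open>(d + 1) ^ card W\<close>, but all lie in the span of
  \<open>(K * d + 1) ^ card V\<close> monomials. As \<open>card V < card W\<close>, a large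
  \<open>d\<close> forces a linear relation among the products.\<close>

lemma algebraic_dependence:
  fixes \<Psi> :: "'w \<Rightarrow> ('v \<Rightarrow> 'k::field) \<Rightarrow> 'k"
  assumes V: "finite V" and W: "finite W" and card: "card V < card W"
    and \<Psi>: "\<And>w. w \<in> W \<Longrightarrow> poly_fun_le V C (\<Psi> w)"
  shows "\<exists>d c. (\<exists>\<beta>\<in>W \<rightarrow>\<^sub>E {..d}. c \<beta> \<noteq> 0) \<and>
    (\<forall>v. (\<Sum>\<beta>\<in>W \<rightarrow>\<^sub>E {..d}. c \<beta> * (\<Prod>w\<in>W. \<Psi> w v ^ \<beta> w)) = 0)"
proof -
  define K where "K = card W * C"
  \<comment> \<open>Chosen so that \<open>((K + 1) * (d + 1)) ^ card V\<close> equals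
    \<open>d * (d + 1) ^ card V\<close>, just below \<open>(d + 1) ^ (card V + 1)\<close>.\<close>
  define d where "d = (K + 1) ^ card V"
  have "poly_fun_le V (K * d) (\<lambda>v. \<Prod>w\<in>W. \<Psi> w v ^ \<beta> w)" if "\<beta> \<in> W \<rightarrow>\<^sub>E {..d}" for \<beta>
  proof -
    have "poly_fun_le V (C * d) (\<lambda>v. \<Psi> w v ^ \<beta> w)" if "w \<in> W" for w
      using poly_fun_le_mono[OF poly_fun_le_power[OF \<Psi>[OF that]]] that \<open>\<beta> \<in> _\<close>
      by (auto simp: PiE_iff)
    from poly_fun_le_prod[OF W this] show ?thesis by (simp add: K_def mult.assoc)
  qed
  then have "\<forall>\<beta>\<in>W \<rightarrow>\<^sub>E {..d}. \<exists>c. \<forall>v.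
      (\<Prod>w\<in>W. \<Psi> w v ^ \<beta> w) = (\<Sum>\<alpha>\<in>V \<rightarrow>\<^sub>E {..K * d}. c \<alpha> * (\<Prod>k\<in>V. v k ^ \<alpha> k))"
    by (intro ballI poly_fun_le_coeffs[OF V]) simp
  from bchoice[OF this] obtain M where M: "\<And>\<beta> v. \<beta> \<in> W \<rightarrow>\<^sub>E {..d} \<Longrightarrow>
      (\<Prod>w\<in>W. \<Psi> w v ^ \<beta> w) = (\<Sum>\<alpha>\<in>V \<rightarrow>\<^sub>E {..K * d}. M \<beta> \<alpha> * (\<Prod>k\<in>V. v k ^ \<alpha> k))"
    by blast
  have "(K * d + 1) ^ card V \<le> ((K + 1) * (d + 1)) ^ card V"
    by (intro power_mono) auto
  also have "\<dots> = d * (d + 1) ^ card V" unfolding power_mult_distrib by (simp add: d_def)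
  also have "\<dots> < (d + 1) * (d + 1) ^ card V" by simp
  also have "\<dots> = (d + 1) ^ (card V + 1)" by simp
  also have "\<dots> \<le> (d + 1) ^ card W" using card by (intro power_increasing) auto
  finally have "card (V \<rightarrow>\<^sub>E {..K * d}) < card (W \<rightarrow>\<^sub>E {..d})"
    using V W by (simp add: card_PiE)
  with underdetermined_system[of "V \<rightarrow>\<^sub>E {..K * d}" "W \<rightarrow>\<^sub>E {..d}" M] V W
  obtain c where nz: "\<exists>\<beta>\<in>W \<rightarrow>\<^sub>E {..d}. c \<beta> \<noteq> 0"
    and c: "\<And>\<alpha>. \<alpha> \<in> V \<rightarrow>\<^sub>E {..K * d} \<Longrightarrow> (\<Sum>\<beta>\<in>W \<rightarrow>\<^sub>E {..d}. c \<beta> * M \<beta> \<alpha>) = 0"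
    by (auto simp: finite_PiE)
  have "(\<Sum>\<beta>\<in>W \<rightarrow>\<^sub>E {..d}. c \<beta> * (\<Prod>w\<in>W. \<Psi> w v ^ \<beta> w)) = 0" for v
  proof -
    have "(\<Sum>\<beta>\<in>W \<rightarrow>\<^sub>E {..d}. c \<beta> * (\<Prod>w\<in>W. \<Psi> w v ^ \<beta> w))
        = (\<Sum>\<beta>\<in>W \<rightarrow>\<^sub>E {..d}. \<Sum>\<alpha>\<in>V \<rightarrow>\<^sub>E {..K * d}. c \<beta> * M \<beta> \<alpha> * (\<Prod>k\<in>V. v k ^ \<alpha> k))"
      by (simp add: M sum_distrib_left mult.assoc)
    also have "\<dots> = (\<Sum>\<alpha>\<in>V \<rightarrow>\<^sub>E {..K * d}. (\<Sum>\<beta>\<in>W \<rightarrow>\<^sub>E {..d}. c \<beta> * M \<beta> \<alpha>) * (\<Prod>k\<in>V. v k ^ \<alpha> k))"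
      by (subst sum.swap) (simp add: sum_distrib_right)
    also have "\<dots> = 0" by (simp add: c)
    finally show ?thesis .
  qed
  with nz show ?thesis by blast
qed

section \<open>Null zero sets and generic fibres\<close>

lemma sum_PiE_insert:
  assumes "q \<notin> V"
  shows "(\<Sum>\<beta>\<in>insert q V \<rightarrow>\<^sub>E D. \<phi> \<beta>) = (\<Sum>j\<in>D. \<Sum>\<beta>\<in>V \<rightarrow>\<^sub>E D. \<phi> (\<beta>(q := j)))"
proof -
  have "inj_on (\<lambda>(j, \<beta>). \<beta>(q := j)) (D \<times> (V \<rightarrow>\<^sub>E D))"
    by (rule inj_combinator[OF assms])
  then show ?thesis
    unfolding PiE_insert_eq sum.cartesian_product
    by (simp only: sum.reindex o_def case_prod_unfold)
qed

text \<open>Reads a polynomial as univariate in \<open>v q\<close>, with coefficients that are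
  polynomials in the other variables; both the Fubini argument and the elimination rest on this
  form.\<close>

lemma sum_monomials_insert:
  fixes v :: "'v \<Rightarrow> 'k::comm_ring_1"
  assumes "finite V" "q \<notin> V"
  shows "(\<Sum>\<beta>\<in>insert q V \<rightarrow>\<^sub>E D. c \<beta> * (\<Prod>k\<in>insert q V. v k ^ \<beta> k))
    = (\<Sum>j\<in>D. (\<Sum>\<beta>\<in>V \<rightarrow>\<^sub>E D. c (\<beta>(q := j)) * (\<Prod>k\<in>V. v k ^ \<beta> k)) * v q ^ j)"
proof -
  have "(\<Prod>k\<in>V. v k ^ (\<beta>(q := j)) k) = (\<Prod>k\<in>V. v k ^ \<beta> k)" for \<beta> j
    using assms(2) by (intro prod.cong) auto
  then show ?thesis
    using assms unfolding sum_PiE_insert[OF assms(2)] sum_distrib_right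
    by (intro sum.cong refl) (simp add: mult_ac)
qed

text \<open>Induction on the variables by Fubini: some coefficient with respect to the new variable
  is a nonzero polynomial in the old ones. Off its null zero set, the slice in the new variable is a
  finite root set.\<close>

lemma null_sets_poly_zeros:
  fixes c :: "('v \<Rightarrow> nat) \<Rightarrow> complex"
  assumes "finite V" "\<exists>\<alpha>\<in>V \<rightarrow>\<^sub>E {..d}. c \<alpha> \<noteq> 0"
  shows "{v \<in> space (Pi\<^sub>M V (\<lambda>_. lborel)). (\<Sum>\<alpha>\<in>V \<rightarrow>\<^sub>E {..d}. c \<alpha> * (\<Prod>k\<in>V. v k ^ \<alpha> k)) = 0}
    \<in> null_sets (Pi\<^sub>M V (\<lambda>_. lborel :: complex measure))"
  using assms
proof (induction V arbitrary: c rule: finite_induct)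
  case empty
  then have "{v \<in> space (Pi\<^sub>M {} (\<lambda>_. lborel :: complex measure)).
      (\<Sum>\<alpha>\<in>({} :: 'v set) \<rightarrow>\<^sub>E {..d}. c \<alpha> * (\<Prod>k\<in>{}. v k ^ \<alpha> k)) = 0} = {}"
    by simp
  then show ?case by (simp only: null_sets.empty_sets)
next
  case (insert q V)
  interpret product_sigma_finite "\<lambda>_ :: 'v. lborel :: complex measure" by standard
  let ?L = "\<lambda>V :: 'v set. Pi\<^sub>M V (\<lambda>_. lborel :: complex measure)"
  let ?p = "\<lambda>v. \<Sum>\<alpha>\<in>insert q V \<rightarrow>\<^sub>E {..d}. c \<alpha> * (\<Prod>k\<in>insert q V. v k ^ \<alpha> k)"
  let ?a = "\<lambda>j v. \<Sum>\<beta>\<in>V \<rightarrow>\<^sub>E {..d}. c (\<beta>(q := j)) * (\<Prod>k\<in>V. v k ^ \<beta> k)"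
  let ?Z = "{v \<in> space (?L (insert q V)). ?p v = 0}"
  have [measurable]: "?p \<in> borel_measurable (?L (insert q V))"
    by (intro borel_measurable_sum borel_measurable_times borel_measurable_prod
        borel_measurable_power borel_measurable_const) auto
  have Z [measurable]: "?Z \<in> sets (?L (insert q V))" by measurable
  \<comment> \<open>The exponent \<open>\<alpha> q\<close> selects a power of the new variable whose
    coefficient is not the zero polynomial.\<close>
  obtain \<alpha> where \<alpha>: "\<alpha> \<in> insert q V \<rightarrow>\<^sub>E {..d}" "c \<alpha> \<noteq> 0" using insert.prems by auto
  have "restrict \<alpha> V \<in> V \<rightarrow>\<^sub>E {..d}" "(restrict \<alpha> V)(q := \<alpha> q) = \<alpha>" "\<alpha> q \<le> d"
    using \<alpha>(1) by (auto simp: PiE_iff extensional_def restrict_def)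
  then have null: "{v \<in> space (?L V). ?a (\<alpha> q) v = 0} \<in> null_sets (?L V)"
    using \<alpha>(2) by (intro insert.IH bexI[of _ "restrict \<alpha> V"])
      (simp_all only: not_False_eq_True)
  have slice: "(\<integral>\<^sup>+ y. indicator ?Z (v(q := y)) \<partial>lborel) = 0"
    if "v \<in> space (?L V)" "?a (\<alpha> q) v \<noteq> 0" for v
  proof -
    have "v(q := y) \<in> space (?L (insert q V))" for y
      using that(1) by (auto simp: space_PiM PiE_iff extensional_def)
    moreover have "?p (v(q := y)) = (\<Sum>j\<le>d. ?a j v * y ^ j)" for y
    proof -
      have "(\<Prod>k\<in>V. (v(q := y)) k ^ \<beta> k) = (\<Prod>k\<in>V. v k ^ \<beta> k)" for \<beta> :: "'v \<Rightarrow> nat"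
        using insert.hyps by (intro prod.cong) auto
      then show ?thesis by (simp only: sum_monomials_insert[OF insert.hyps] fun_upd_same)
    qed
    ultimately have "(\<integral>\<^sup>+ y. indicator ?Z (v(q := y)) \<partial>lborel)
        = (\<integral>\<^sup>+ y. indicator {y. (\<Sum>j\<le>d. ?a j v * y ^ j) = 0} y \<partial>lborel)"
      by (intro nn_integral_cong) (simp add: indicator_def)
    moreover have "finite {y. (\<Sum>j\<le>d. ?a j v * y ^ j) = 0}"
      using polyfun_roots_finite[of "\<lambda>j. ?a j v" "\<alpha> q" d] that(2) \<open>\<alpha> q \<le> d\<close> by simp
    then have "{y. (\<Sum>j\<le>d. ?a j v * y ^ j) = 0} \<in> null_sets lborel"
      by (rule finite_imp_null_set_lborel)
    ultimately show ?thesis by (simp add: null_sets_def)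
  qed
  have "emeasure (?L (insert q V)) ?Z = (\<integral>\<^sup>+ v. indicator ?Z v \<partial>?L (insert q V))"
    using Z by simp
  also have "\<dots> = (\<integral>\<^sup>+ v. (\<integral>\<^sup>+ y. indicator ?Z (v(q := y)) \<partial>lborel) \<partial>?L V)"
    using insert.hyps Z by (intro product_nn_integral_insert) auto
  also have "\<dots> = (\<integral>\<^sup>+ v. 0 \<partial>?L V)"
  proof (rule nn_integral_cong_AE)
    show "AE v in ?L V. (\<integral>\<^sup>+ y. indicator ?Z (v(q := y)) \<partial>lborel) = 0"
      using AE_not_in[OF null] AE_space by eventually_elim (use slice in auto)
  qed
  finally show ?case using Z by (auto simp: null_sets_def)
qed

text \<open>Eliminate all variables but one: a relation between \<open>f\<close> and the \<open>\<Psi> i\<close> confines the value of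
  \<open>f\<close> on the fibre over \<open>c\<close> to the roots of a univariate polynomial, which is nonzero for generic
  \<open>c\<close>.\<close>

lemma finite_fibre_values:
  fixes \<Psi> :: "'v \<Rightarrow> ('v \<Rightarrow> complex) \<Rightarrow> complex"
  assumes V: "finite V" and q: "q \<notin> V"
    and \<Psi>: "\<And>i. i \<in> V \<Longrightarrow> poly_fun_le V C (\<Psi> i)" and f: "poly_fun_le V C f"
  shows "\<exists>N \<in> null_sets (Pi\<^sub>M V (\<lambda>_. lborel :: complex measure)).
    \<forall>c. restrict c V \<notin> N \<longrightarrow> finite {f v |v. \<forall>i\<in>V. \<Psi> i v = c i}"
proof -
  \<comment> \<open>The index \<open>q\<close> outside \<open>V\<close> is only a name for the extra
    polynomial \<open>f\<close>, which makes the family one larger than the set of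
    variables.\<close>
  define \<Phi> where "\<Phi> = \<Psi>(q := f)"
  have "\<exists>d c. (\<exists>\<beta>\<in>insert q V \<rightarrow>\<^sub>E {..d}. c \<beta> \<noteq> 0) \<and>
      (\<forall>v. (\<Sum>\<beta>\<in>insert q V \<rightarrow>\<^sub>E {..d}. c \<beta> * (\<Prod>w\<in>insert q V. \<Phi> w v ^ \<beta> w)) = 0)"
    by (rule algebraic_dependence[of V _ C]) (use assms in \<open>auto simp: \<Phi>_def\<close>)
  then obtain d r \<beta> where \<beta>: "\<beta> \<in> insert q V \<rightarrow>\<^sub>E {..d}" "r \<beta> \<noteq> 0"
    and rel: "\<And>v. (\<Sum>\<beta>\<in>insert q V \<rightarrow>\<^sub>E {..d}. r \<beta> * (\<Prod>w\<in>insert q V. \<Phi> w v ^ \<beta> w)) = 0"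
    by auto
  \<comment> \<open>The coefficient of the \<open>j\<close>-th power of \<open>f\<close> in the
    relation, as a polynomial in the values of the \<open>\<Psi> i\<close>.\<close>
  define p where "p = (\<lambda>j c. \<Sum>\<alpha>\<in>V \<rightarrow>\<^sub>E {..d}. r (\<alpha>(q := j)) * (\<Prod>k\<in>V. c k ^ \<alpha> k))"
  have "restrict \<beta> V \<in> V \<rightarrow>\<^sub>E {..d}" "(restrict \<beta> V)(q := \<beta> q) = \<beta>" and le: "\<beta> q \<le> d"
    using \<beta>(1) by (auto simp: PiE_iff extensional_def restrict_def)
  then have null: "{c \<in> space (Pi\<^sub>M V (\<lambda>_. lborel)). p (\<beta> q) c = 0}
      \<in> null_sets (Pi\<^sub>M V (\<lambda>_. lborel :: complex measure))" (is "?N \<in> _")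
    unfolding p_def using \<beta>(2)
    by (intro null_sets_poly_zeros V bexI[of _ "restrict \<beta> V"])
      (simp_all only: not_False_eq_True)
  have "finite {f v |v. \<forall>i\<in>V. \<Psi> i v = c i}" if "restrict c V \<notin> ?N" for c
  proof (rule finite_subset)
    have "p (\<beta> q) (restrict c V) = p (\<beta> q) c" by (simp add: p_def)
    moreover have "restrict c V \<in> space (Pi\<^sub>M V (\<lambda>_. lborel :: complex measure))"
      by (auto simp: space_PiM)
    ultimately have "p (\<beta> q) c \<noteq> 0" using that by auto
    \<comment> \<open>Even when \<open>\<beta> q = 0\<close> the univariate polynomial is nonzero;
      it has finitely many roots in every case.\<close>
    then show "finite {t. (\<Sum>j\<le>d. p j c * t ^ j) = 0}"
      using polyfun_roots_finite[of "\<lambda>j. p j c" "\<beta> q" d] le by simp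
    have "(\<Sum>j\<le>d. p j c * f v ^ j) = 0" if "\<forall>i\<in>V. \<Psi> i v = c i" for v
    proof -
      have "\<Phi> w v = c w" if "w \<in> V" for w
        using that q \<open>\<forall>i\<in>V. _\<close> by (auto simp: \<Phi>_def)
      then have "p j (\<lambda>w. \<Phi> w v) = p j c" for j by (simp add: p_def)
      moreover have "(\<Sum>j\<le>d. p j (\<lambda>w. \<Phi> w v) * \<Phi> q v ^ j) = 0"
        using rel[of v] unfolding p_def sum_monomials_insert[OF V q, of r "\<lambda>w. \<Phi> w v"] .
      ultimately show ?thesis by (simp add: \<Phi>_def)
    qed
    then show "{f v |v. \<forall>i\<in>V. \<Psi> i v = c i} \<subseteq> {t. (\<Sum>j\<le>d. p j c * t ^ j) = 0}" by auto
  qed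
  with null show ?thesis by blast
qed

section \<open>Closure properties of polynomial functions\<close>

definition poly_fun :: "'v set \<Rightarrow> (('v \<Rightarrow> 'k::comm_ring_1) \<Rightarrow> 'k) \<Rightarrow> bool" where
  "poly_fun V f \<longleftrightarrow> (\<exists>d. poly_fun_le V d f)"

lemma poly_fun_const: "poly_fun V (\<lambda>_. c)"
  using poly_fun_le_const[of V 0 c] by (auto simp: poly_fun_def)

lemma poly_fun_var: "finite V \<Longrightarrow> q \<in> V \<Longrightarrow> poly_fun V (\<lambda>v. v q)"
  unfolding poly_fun_def by (blast intro: poly_fun_le_var)

lemma poly_fun_add: "poly_fun V f \<Longrightarrow> poly_fun V g \<Longrightarrow> poly_fun V (\<lambda>v. f v + g v)"
  unfolding poly_fun_def
  by (elim exE, rule exI, rule poly_fun_le_add)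
    (erule poly_fun_le_mono, rule max.cobounded1, erule poly_fun_le_mono, rule max.cobounded2)

lemma poly_fun_mult: "poly_fun V f \<Longrightarrow> poly_fun V g \<Longrightarrow> poly_fun V (\<lambda>v. f v * g v)"
  unfolding poly_fun_def by (blast intro: poly_fun_le_mult)

lemma poly_fun_power: "poly_fun V f \<Longrightarrow> poly_fun V (\<lambda>v. f v ^ j)"
  unfolding poly_fun_def by (blast intro: poly_fun_le_power)

lemma poly_fun_uminus: "poly_fun V f \<Longrightarrow> poly_fun V (\<lambda>v. - f v)"
  using poly_fun_mult[OF poly_fun_const[of V "- 1"], of f] by simp

lemma poly_fun_diff: "poly_fun V f \<Longrightarrow> poly_fun V g \<Longrightarrow> poly_fun V (\<lambda>v. f v - g v)"
  using poly_fun_add[OF _ poly_fun_uminus, of V f g] by simp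

lemma poly_fun_sum: "(\<And>s. s \<in> S \<Longrightarrow> poly_fun V (f s)) \<Longrightarrow> poly_fun V (\<lambda>v. \<Sum>s\<in>S. f s v)"
  by (induction S rule: infinite_finite_induct) (simp_all add: poly_fun_const poly_fun_add)

lemma poly_fun_prod: "(\<And>s. s \<in> S \<Longrightarrow> poly_fun V (f s)) \<Longrightarrow> poly_fun V (\<lambda>v. \<Prod>s\<in>S. f s v)"
  by (induction S rule: infinite_finite_induct) (simp_all add: poly_fun_const poly_fun_mult)

text \<open>Recovers one degree bound for a whole finite family, the form in which
  \<open>finite_fibre_values\<close> takes its polynomials.\<close>

lemma poly_fun_uniform_bound:
  assumes "finite S" "\<And>s. s \<in> S \<Longrightarrow> poly_fun V (f s)"
  shows "\<exists>d. \<forall>s\<in>S. poly_fun_le V d (f s)"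
  using assms
proof (induction S rule: finite_induct)
  case (insert s S)
  then obtain d where "\<forall>s\<in>S. poly_fun_le V d (f s)" by auto
  moreover obtain e where "poly_fun_le V e (f s)"
    using insert.prems[of s] by (auto simp: poly_fun_def)
  ultimately have "\<forall>s\<in>insert s S. poly_fun_le V (max d e) (f s)"
    by (auto intro: poly_fun_le_mono)
  then show ?case ..
qed simp

section \<open>Evaluation of formal polynomials and derivatives\<close>

definition mon_eval :: "'v mon \<Rightarrow> ('v \<Rightarrow> complex) \<Rightarrow> complex" where
  "mon_eval \<alpha> v = (\<Prod>k\<in>Poly_Mapping.keys \<alpha>. v k ^ Poly_Mapping.lookup \<alpha> k)"

lemma mon_eval_zero [simp]: "mon_eval 0 v = 1"
  by (simp add: mon_eval_def)

lemma mon_eval_cong: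
  "(\<And>k. k \<in> Poly_Mapping.keys \<alpha> \<Longrightarrow> v k = w k) \<Longrightarrow> mon_eval \<alpha> v = mon_eval \<alpha> w"
  by (simp add: mon_eval_def)

lemma poly_fun_mon_eval:
  "(\<And>k. k \<in> Poly_Mapping.keys \<alpha> \<Longrightarrow> poly_fun V (\<lambda>v. X v k)) \<Longrightarrow>
    poly_fun V (\<lambda>v. mon_eval \<alpha> (X v))"
  unfolding mon_eval_def by (intro poly_fun_prod poly_fun_power)

lemma keys_minus_subset:
  "Poly_Mapping.keys (\<alpha> - \<beta> :: 'v mon) \<subseteq> Poly_Mapping.keys \<alpha>"
  by (auto simp: in_keys_iff lookup_minus)

text \<open>Replaces the support of \<open>p\<close> by a fixed index set, so that all polynomials
  of bounded degree are summed over the same monomials.\<close>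

lemma peval_eq_sum:
  assumes "finite S" "Poly_Mapping.keys p \<subseteq> S"
  shows "peval p v = (\<Sum>\<alpha>\<in>S. Poly_Mapping.lookup p \<alpha> * mon_eval \<alpha> v)"
  unfolding peval_def mon_eval_def
  using assms by (intro sum.mono_neutral_left) (auto simp: in_keys_iff)

lemma peval_add: "peval (p + q) v = peval p v + peval q v"
proof -
  let ?S = "Poly_Mapping.keys p \<union> Poly_Mapping.keys q"
  have "Poly_Mapping.keys (p + q) \<subseteq> ?S" by (rule Poly_Mapping.keys_add)
  then show ?thesis
    by (simp add: peval_eq_sum[of ?S] lookup_add distrib_right sum.distrib)
qed

lemma peval_single: "peval (Poly_Mapping.single \<alpha> c) v = c * mon_eval \<alpha> v"
  by (subst peval_eq_sum[of "{\<alpha>}"]) auto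

lemma peval_sum_single:
  "peval (\<Sum>s\<in>S. Poly_Mapping.single (\<phi> s) (r s)) v = (\<Sum>s\<in>S. r s * mon_eval (\<phi> s) v)"
proof (induction S rule: infinite_finite_induct)
  case (infinite S)
  then show ?case by (simp add: peval_def)
next
  case empty
  then show ?case by (simp add: peval_def)
qed (simp add: peval_add peval_single)

lemma peval_pdiff:
  assumes "finite S" "Poly_Mapping.keys p \<subseteq> S"
  shows "peval (pdiff k p) v = (\<Sum>\<alpha>\<in>S. of_nat (Poly_Mapping.lookup \<alpha> k) *
    Poly_Mapping.lookup p \<alpha> * mon_eval (\<alpha> - Poly_Mapping.single k 1) v)"
  unfolding pdiff_def peval_sum_single
  using assms by (intro sum.mono_neutral_left) (auto simp: in_keys_iff)

section \<open>The KKT system as a polynomial map onto coefficients\<close>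

text \<open>The right side of the stationarity equation for variable \<open>k\<close>, as a function
  of the coefficients. The slot \<open>u i 0\<close> holds the multiplier; its appearance in the
  inner sum is harmless, since the monomial \<open>0\<close> has exponent \<open>0\<close> in
  \<open>k\<close>.\<close>

definition lagrange_sum ::
  "nat \<Rightarrow> (nat \<Rightarrow> nat) \<Rightarrow> nat set \<Rightarrow> (nat \<Rightarrow> nat mon \<Rightarrow> complex) \<Rightarrow> (nat \<Rightarrow> complex) \<Rightarrow> nat \<Rightarrow> complex"
where
  "lagrange_sum n a A u z k = (\<Sum>i\<in>A. u i 0 * (\<Sum>\<beta>\<in>monomials n (a i).
     of_nat (Poly_Mapping.lookup \<beta> k) * u i \<beta> * mon_eval (\<beta> - Poly_Mapping.single k 1) z))"

text \<open>Its negative is the value that the constant coefficient must have for the polynomial to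
  vanish at \<open>z\<close>.\<close>

definition nonconst_part :: "nat \<Rightarrow> nat \<Rightarrow> (nat mon \<Rightarrow> complex) \<Rightarrow> (nat \<Rightarrow> complex) \<Rightarrow> complex" where
  "nonconst_part n d w z = (\<Sum>\<beta>\<in>monomials n d - {0}. w \<beta> * mon_eval \<beta> z)"

lemma keys_monomials: "\<beta> \<in> monomials n d \<Longrightarrow> k \<in> Poly_Mapping.keys \<beta> \<Longrightarrow> k < n"
  by (auto simp: monomials_def)

lemma keys_monomials2:
  "\<beta> \<in> monomials2 n m a0 b0 \<Longrightarrow> q \<in> Poly_Mapping.keys \<beta> \<Longrightarrow> q \<in> Inl ` {..<n} \<union> Inr ` {..<m}"
  by (auto simp: monomials2_def)

lemma zero_in_monomials: "0 \<in> monomials n d"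
  by (simp add: monomials_def)

lemma poly_fun_lagrange_sum:
  assumes "\<And>i \<beta>. i \<in> A \<Longrightarrow> \<beta> \<in> monomials n (a i) \<Longrightarrow> poly_fun V (\<lambda>v. u v i \<beta>)"
    and "\<And>k. k < n \<Longrightarrow> poly_fun V (\<lambda>v. z v k)"
  shows "poly_fun V (\<lambda>v. lagrange_sum n a A (u v) (z v) k)"
  unfolding lagrange_sum_def
  by (intro poly_fun_sum poly_fun_mult poly_fun_const poly_fun_mon_eval assms zero_in_monomials)
    (auto dest: keys_monomials keys_minus_subset[THEN subsetD])

lemma poly_fun_nonconst_part:
  assumes "\<And>\<beta>. \<beta> \<in> monomials n d \<Longrightarrow> poly_fun V (\<lambda>v. w v \<beta>)"
    and "\<And>k. k < n \<Longrightarrow> poly_fun V (\<lambda>v. z v k)"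
  shows "poly_fun V (\<lambda>v. nonconst_part n d (w v) (z v))"
  unfolding nonconst_part_def
  by (intro poly_fun_sum poly_fun_mult poly_fun_mon_eval assms) (auto dest: keys_monomials)

lemma lagrange_sum_eq:
  assumes g: "\<And>i. i \<in> A \<Longrightarrow> g i \<in> polys n (a i)"
    and u: "\<And>i \<beta>. i \<in> A \<Longrightarrow> u i \<beta> = (if \<beta> = 0 then lam i else Poly_Mapping.lookup (g i) \<beta>)"
    and z: "\<And>k. k < n \<Longrightarrow> z k = x k"
  shows "lagrange_sum n a A u z k = (\<Sum>i\<in>A. lam i * peval (pdiff k (g i)) x)"
  unfolding lagrange_sum_def
proof (intro sum.cong refl)
  fix i assume i: "i \<in> A"
  have "mon_eval (\<beta> - Poly_Mapping.single k 1) z = mon_eval (\<beta> - Poly_Mapping.single k 1) x"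
    if "\<beta> \<in> monomials n (a i)" for \<beta>
    using that z by (intro mon_eval_cong) (blast dest: keys_monomials keys_minus_subset[THEN subsetD])
  then have "(\<Sum>\<beta>\<in>monomials n (a i). of_nat (Poly_Mapping.lookup \<beta> k) * u i \<beta> *
        mon_eval (\<beta> - Poly_Mapping.single k 1) z) = peval (pdiff k (g i)) x"
    using g[OF i] u[OF i] by (subst peval_pdiff[OF finite_monomials[of n "a i"]])
      (auto simp: polys_def intro!: sum.cong)
  then show "u i 0 * (\<Sum>\<beta>\<in>monomials n (a i). of_nat (Poly_Mapping.lookup \<beta> k) * u i \<beta> *
        mon_eval (\<beta> - Poly_Mapping.single k 1) z) = lam i * peval (pdiff k (g i)) x"
    using u[OF i, of 0] by simp
qed

lemma nonconst_part_eq: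
  assumes p: "p \<in> polys n d"
    and w: "\<And>\<beta>. \<beta> \<noteq> 0 \<Longrightarrow> w \<beta> = Poly_Mapping.lookup p \<beta>"
    and z: "\<And>k. k < n \<Longrightarrow> z k = x k"
  shows "nonconst_part n d w z = peval p x - Poly_Mapping.lookup p 0"
proof -
  have "nonconst_part n d w z
      = (\<Sum>\<beta>\<in>monomials n d - {0}. Poly_Mapping.lookup p \<beta> * mon_eval \<beta> x)"
    unfolding nonconst_part_def using w z
    by (intro sum.cong refl arg_cong2[of _ _ _ _ "(*)"] mon_eval_cong) (auto dest: keys_monomials)
  also have "\<dots> = peval p x - Poly_Mapping.lookup p 0"
    using p by (subst peval_eq_sum[OF finite_monomials[of n d]])
      (auto simp: polys_def sum.remove[OF finite_monomials zero_in_monomials])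
  finally show ?thesis .
qed

text \<open>
  For active sets \<open>A\<close>, \<open>B\<close> of constraints, the KKT system determines the linear coefficients of \<open>F\<close>
  and the constant coefficients of the active \<open>g\<^sub>i\<close>, \<open>h\<^sub>j\<close> as polynomials in the unknowns and in the
  remaining coefficients. There are as many such pivot coefficients as unknowns
  \<open>(x, y, \<lambda>, \<mu>)\<close>, so the pivot indices also serve as names of the unknowns: in the argument \<open>v\<close>, the
  entry at the index of the coefficient of \<open>x\<^sub>k\<close> in \<open>F\<close> stands for \<open>x\<^sub>k\<close> itself (likewise for
  \<open>y\<^sub>k\<close>), the entry at the constant coefficient of \<open>g\<^sub>i\<close> stands for \<open>\<lambda>\<^sub>i\<close>, that of \<open>h\<^sub>j\<close> for \<open>\<mu>\<^sub>j\<close>.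
\<close>

definition linear_mons :: "nat \<Rightarrow> nat \<Rightarrow> (nat + nat) mon set" where
  "linear_mons n m = (\<lambda>q. Poly_Mapping.single q 1) ` (Inl ` {..<n} \<union> Inr ` {..<m})"

definition point_of :: "(coeff_index \<Rightarrow> complex) \<Rightarrow> nat + nat \<Rightarrow> complex" where
  "point_of v q = v (FCoeff (Poly_Mapping.single q 1))"

fun kkt_coeffs ::
  "nat \<Rightarrow> nat \<Rightarrow> nat \<Rightarrow> nat \<Rightarrow> (nat \<Rightarrow> nat) \<Rightarrow> (nat \<Rightarrow> nat) \<Rightarrow> nat set \<Rightarrow> nat set \<Rightarrow>
   coeff_index \<Rightarrow> (coeff_index \<Rightarrow> complex) \<Rightarrow> complex"
where
  "kkt_coeffs n m a0 b0 a b A B (FCoeff \<alpha>) = (\<lambda>v.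
     if \<alpha> \<in> linear_mons n m then
      let q = the_elem (Poly_Mapping.keys \<alpha>) in
      (case q of
        Inl k \<Rightarrow> lagrange_sum n a A (\<lambda>i \<beta>. v (GCoeff i \<beta>)) (\<lambda>k. point_of v (Inl k)) k
      | Inr k \<Rightarrow> lagrange_sum m b B (\<lambda>j \<beta>. v (HCoeff j \<beta>)) (\<lambda>k. point_of v (Inr k)) k)
      - (\<Sum>\<beta>\<in>monomials2 n m a0 b0 - {\<alpha>}. of_nat (Poly_Mapping.lookup \<beta> q) * v (FCoeff \<beta>) *
          mon_eval (\<beta> - Poly_Mapping.single q 1) (point_of v))
     else v (FCoeff \<alpha>))"
| "kkt_coeffs n m a0 b0 a b A B (GCoeff i \<alpha>) = (\<lambda>v.
     if i \<in> A \<and> \<alpha> = 0 then - nonconst_part n (a i) (\<lambda>\<beta>. v (GCoeff i \<beta>)) (\<lambda>k. point_of v (Inl k))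
     else v (GCoeff i \<alpha>))"
| "kkt_coeffs n m a0 b0 a b A B (HCoeff j \<alpha>) = (\<lambda>v.
     if j \<in> B \<and> \<alpha> = 0 then - nonconst_part m (b j) (\<lambda>\<beta>. v (HCoeff j \<beta>)) (\<lambda>k. point_of v (Inr k))
     else v (HCoeff j \<alpha>))"

text \<open>The argument of \<open>kkt_coeffs\<close> that belongs to a solution: the unknowns
  overwrite the pivot entries of the coefficient vector \<open>c\<close>. The keys of a linear
  monomial form a singleton, from which \<open>the_elem\<close> recovers the variable.\<close>

fun kkt_subst ::
  "nat \<Rightarrow> nat \<Rightarrow> nat set \<Rightarrow> nat set \<Rightarrow> (nat + nat \<Rightarrow> complex) \<Rightarrow> (nat \<Rightarrow> complex) \<Rightarrow> (nat \<Rightarrow> complex) \<Rightarrow>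
   (coeff_index \<Rightarrow> complex) \<Rightarrow> coeff_index \<Rightarrow> complex"
where
  "kkt_subst n m A B z lam mu c (FCoeff \<alpha>) =
    (if \<alpha> \<in> linear_mons n m then z (the_elem (Poly_Mapping.keys \<alpha>)) else c (FCoeff \<alpha>))"
| "kkt_subst n m A B z lam mu c (GCoeff i \<alpha>) = (if i \<in> A \<and> \<alpha> = 0 then lam i else c (GCoeff i \<alpha>))"
| "kkt_subst n m A B z lam mu c (HCoeff j \<alpha>) = (if j \<in> B \<and> \<alpha> = 0 then mu j else c (HCoeff j \<alpha>))"

text \<open>This is where positive degrees of \<open>F\<close> enter: the linear coefficients used
  as pivots must be available.\<close>

lemma single_in_monomials2:
  assumes "0 < a0" "0 < b0" "q \<in> Inl ` {..<n} \<union> Inr ` {..<m}"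
  shows "Poly_Mapping.single q 1 \<in> monomials2 n m a0 b0"
  using assms by (auto simp: monomials2_def lookup_single when_def)

lemma poly_fun_point_of:
  assumes "0 < a0" "0 < b0" "q \<in> Inl ` {..<n} \<union> Inr ` {..<m}"
  shows "poly_fun (coeff_indices n m l1 l2 a0 b0 a b) (\<lambda>v. point_of v q)"
proof -
  from single_in_monomials2[OF assms] show ?thesis
    unfolding point_of_def
    by (intro poly_fun_var finite_coeff_indices) (simp add: coeff_indices_def)
qed

text \<open>All entries read by \<open>kkt_coeffs\<close> carry indices of actual coefficients, so
  the map has as many variables as components.\<close>

lemma poly_fun_kkt_coeffs:
  assumes pos: "0 < a0" "0 < b0" and AB: "A \<subseteq> {..<l1}" "B \<subseteq> {..<l2}"
    and t: "t \<in> coeff_indices n m l1 l2 a0 b0 a b"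
  shows "poly_fun (coeff_indices n m l1 l2 a0 b0 a b) (kkt_coeffs n m a0 b0 a b A B t)"
    (is "poly_fun ?I _")
proof -
  note var = poly_fun_var[OF finite_coeff_indices]
  have F: "poly_fun ?I (\<lambda>v. v (FCoeff \<beta>))" if "\<beta> \<in> monomials2 n m a0 b0" for \<beta>
    using that by (intro var) (auto simp: coeff_indices_def)
  have G: "poly_fun ?I (\<lambda>v. v (GCoeff i \<beta>))" if "i < l1" "\<beta> \<in> monomials n (a i)" for i \<beta>
    using that by (intro var) (auto simp: coeff_indices_def)
  have H: "poly_fun ?I (\<lambda>v. v (HCoeff i \<beta>))" if "i < l2" "\<beta> \<in> monomials m (b i)" for i \<beta>
    using that by (intro var) (auto simp: coeff_indices_def)
  note pt = poly_fun_point_of[OF pos]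
  show ?thesis
  proof (cases t)
    case (FCoeff \<alpha>)
    show ?thesis
    proof (cases "\<alpha> \<in> linear_mons n m")
      case True
      have pt': "poly_fun ?I (\<lambda>v. mon_eval (\<beta> - Poly_Mapping.single q 1) (point_of v))"
        if "\<beta> \<in> monomials2 n m a0 b0" for \<beta> q
        by (intro poly_fun_mon_eval pt keys_monomials2[OF that])
          (blast dest: keys_minus_subset[THEN subsetD])
      obtain q where "the_elem (Poly_Mapping.keys \<alpha>) = q" by simp
      moreover have "poly_fun ?I (\<lambda>v. lagrange_sum n a A (\<lambda>i \<beta>. v (GCoeff i \<beta>)) (\<lambda>k. point_of v (Inl k)) k)"
        "poly_fun ?I (\<lambda>v. lagrange_sum m b B (\<lambda>j \<beta>. v (HCoeff j \<beta>)) (\<lambda>k. point_of v (Inr k)) k)" for k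
        using AB by (auto intro!: poly_fun_lagrange_sum G H pt)
      ultimately show ?thesis
        using FCoeff True
        by (cases q) (auto simp: Let_def
            intro!: poly_fun_diff poly_fun_sum poly_fun_mult poly_fun_const F pt'[unfolded One_nat_def])
    next
      case False
      then show ?thesis using FCoeff t F by (auto simp: coeff_indices_def)
    qed
  next
    case (GCoeff i \<alpha>)
    then have "i < l1" "\<alpha> \<in> monomials n (a i)" using t by (auto simp: coeff_indices_def)
    then show ?thesis
      by (cases "i \<in> A \<and> \<alpha> = 0")
        (auto simp: GCoeff intro!: poly_fun_uminus poly_fun_nonconst_part G pt)
  next
    case (HCoeff j \<alpha>)
    then have "j < l2" "\<alpha> \<in> monomials m (b j)" using t by (auto simp: coeff_indices_def)
    then show ?thesis
      by (cases "j \<in> B \<and> \<alpha> = 0")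
        (auto simp: HCoeff intro!: poly_fun_uminus poly_fun_nonconst_part H pt)
  qed
qed

lemma point_of_kkt_subst:
  "q \<in> Inl ` {..<n} \<union> Inr ` {..<m} \<Longrightarrow> point_of (kkt_subst n m A B z lam mu c) q = z q"
  unfolding point_of_def by (simp add: linear_mons_def)

text \<open>Reads the stationarity equation for the variable \<open>q\<close> as an equation for the coefficient of
  \<open>q\<close> in \<open>F\<close>. The entries of \<open>v\<close> at other linear monomials are coordinates of the point, not
  coefficients of \<open>F\<close>, but they occur with the factor \<open>0\<close>.\<close>

lemma linear_coeff_eq:
  assumes pos: "0 < a0" "0 < b0" and F: "F \<in> polys2 n m a0 b0"
    and q: "q \<in> Inl ` {..<n} \<union> Inr ` {..<m}"
    and v: "v = kkt_subst n m A B z lam mu (coeff_of F g h)"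
  shows "(\<Sum>\<beta>\<in>monomials2 n m a0 b0 - {Poly_Mapping.single q 1}. of_nat (Poly_Mapping.lookup \<beta> q) *
      v (FCoeff \<beta>) * mon_eval (\<beta> - Poly_Mapping.single q 1) (point_of v))
    = peval (pdiff q F) z - Poly_Mapping.lookup F (Poly_Mapping.single q 1)"
proof -
  let ?e = "Poly_Mapping.single q 1 :: (nat + nat) mon"
  let ?M = "monomials2 n m a0 b0"
  have e: "?e \<in> ?M" by (rule single_in_monomials2[OF pos q])
  have "(\<Sum>\<beta>\<in>?M - {?e}. of_nat (Poly_Mapping.lookup \<beta> q) * v (FCoeff \<beta>) * mon_eval (\<beta> - ?e) (point_of v))
      = (\<Sum>\<beta>\<in>?M - {?e}. of_nat (Poly_Mapping.lookup \<beta> q) * Poly_Mapping.lookup F \<beta> * mon_eval (\<beta> - ?e) z)"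
  proof (intro sum.cong refl)
    fix \<beta> assume \<beta>: "\<beta> \<in> ?M - {?e}"
    have "mon_eval (\<beta> - ?e) (point_of v) = mon_eval (\<beta> - ?e) z"
      unfolding v using \<beta>
      by (intro mon_eval_cong point_of_kkt_subst keys_monomials2[of \<beta> n m a0 b0])
        (blast dest: keys_minus_subset[THEN subsetD])+
    moreover have "Poly_Mapping.lookup \<beta> q = 0" if lin: "\<beta> \<in> linear_mons n m"
    proof -
      obtain r where "\<beta> = Poly_Mapping.single r 1" using lin unfolding linear_mons_def by blast
      then show ?thesis using \<beta> by (auto simp: lookup_single when_def)
    qed
    then have "of_nat (Poly_Mapping.lookup \<beta> q) * v (FCoeff \<beta>)
        = of_nat (Poly_Mapping.lookup \<beta> q) * Poly_Mapping.lookup F \<beta>"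
      by (auto simp: v)
    ultimately show "of_nat (Poly_Mapping.lookup \<beta> q) * v (FCoeff \<beta>) * mon_eval (\<beta> - ?e) (point_of v)
        = of_nat (Poly_Mapping.lookup \<beta> q) * Poly_Mapping.lookup F \<beta> * mon_eval (\<beta> - ?e) z"
      by simp
  qed
  moreover have "Poly_Mapping.keys F \<subseteq> ?M" using F by (simp add: polys2_def)
  ultimately show ?thesis
    by (simp add: peval_pdiff[OF finite_monomials2] sum.remove[OF finite_monomials2 e])
qed

text \<open>Every solution lies in the fibre of some \<open>kkt_coeffs\<close> over the given
  coefficient vector. The witnesses are the sets of all constraints vanishing at the point, and
  \<open>kkt_subst\<close> applied to the point and its multipliers.\<close>

lemma kkt_solution_coeffs:
  assumes E: "EX1 \<union> EX2 = {..<l1}" "EY1 \<union> EY2 = {..<l2}" and pos: "0 < a0" "0 < b0"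
    and F: "F \<in> polys2 n m a0 b0" and g: "g \<in> poly_tuples n l1 a" and h: "h \<in> poly_tuples m l2 b"
    and sol: "(x, y) \<in> kkt_solutions n m EX1 EX2 EY1 EY2 G1 H1 F g h"
  shows "\<exists>A B v. A \<subseteq> {..<l1} \<and> B \<subseteq> {..<l2} \<and>
    (\<forall>t\<in>coeff_indices n m l1 l2 a0 b0 a b. kkt_coeffs n m a0 b0 a b A B t v = coeff_of F g h t) \<and>
    (\<forall>k<n. point_of v (Inl k) = x $ k) \<and> (\<forall>k<m. point_of v (Inr k) = y $ k)"
proof -
  define X Y where "X = (\<lambda>k. x $ k)" and "Y = (\<lambda>k. y $ k)"
  define lam mu where "lam = (\<lambda>i. lagrange_x n G1 F x y $ i)" and "mu = (\<lambda>i. lagrange_y m H1 F x y $ i)"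
  define A where "A = {i\<in>{..<l1}. peval (g i) X = 0}"
  define B where "B = {j\<in>{..<l2}. peval (h j) Y = 0}"
  define v where "v = kkt_subst n m A B (case_sum X Y) lam mu (coeff_of F g h)"
  have xg: "xgrad n F x y = vec n (\<lambda>k. \<Sum>i<l1. lam i * grad n (g i) x $ k)"
    and yg: "ygrad m F x y = vec m (\<lambda>k. \<Sum>j<l2. mu j * grad m (h j) y $ k)"
    and zx: "i \<in> EX1 \<Longrightarrow> peval (g i) X = 0" "i \<in> EX2 \<Longrightarrow> lam i * peval (g i) X = 0"
    and zy: "i \<in> EY1 \<Longrightarrow> peval (h i) Y = 0" "i \<in> EY2 \<Longrightarrow> mu i * peval (h i) Y = 0" for i
    using sol E by (simp_all add: kkt_solutions_def Let_def lam_def mu_def X_def Y_def)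
  \<comment> \<open>A constraint that does not vanish cannot belong to \<open>EX1\<close>, so
    complementarity in \<open>EX2\<close> makes its multiplier zero.\<close>
  have lam: "lam i = 0" if "i \<in> {..<l1} - A" for i
    using that zx E by (auto simp: A_def)
  have mu: "mu j = 0" if "j \<in> {..<l2} - B" for j
    using that zy E by (auto simp: B_def)
  have dx: "peval (pdiff (Inl k) F) (case_sum X Y) = (\<Sum>i\<in>A. lam i * peval (pdiff k (g i)) X)"
    if "k < n" for k
  proof -
    have "peval (pdiff (Inl k) F) (case_sum X Y) = (\<Sum>i<l1. lam i * peval (pdiff k (g i)) X)"
      using arg_cong[OF xg, of "\<lambda>w. w $ k"] that by (simp add: xgrad_def grad_def X_def Y_def)
    also have "\<dots> = (\<Sum>i\<in>A. lam i * peval (pdiff k (g i)) X)"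
      using lam by (intro sum.mono_neutral_right) (auto simp: A_def)
    finally show ?thesis .
  qed
  have dy: "peval (pdiff (Inr k) F) (case_sum X Y) = (\<Sum>j\<in>B. mu j * peval (pdiff k (h j)) Y)"
    if "k < m" for k
  proof -
    have "peval (pdiff (Inr k) F) (case_sum X Y) = (\<Sum>j<l2. mu j * peval (pdiff k (h j)) Y)"
      using arg_cong[OF yg, of "\<lambda>w. w $ k"] that by (simp add: ygrad_def grad_def X_def Y_def)
    also have "\<dots> = (\<Sum>j\<in>B. mu j * peval (pdiff k (h j)) Y)"
      using mu by (intro sum.mono_neutral_right) (auto simp: B_def)
    finally show ?thesis .
  qed
  have gi: "g i \<in> polys n (a i)" if "i < l1" for i
    using g that by (auto simp: poly_tuples_def)
  have hj: "h j \<in> polys m (b j)" if "j < l2" for j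
    using h that by (auto simp: poly_tuples_def)
  have pt: "point_of v (Inl k) = X k" if "k < n" for k
    using that by (simp add: v_def point_of_kkt_subst)
  have pt': "point_of v (Inr k) = Y k" if "k < m" for k
    using that by (simp add: v_def point_of_kkt_subst)
  have vG: "v (GCoeff i \<beta>) = (if i \<in> A \<and> \<beta> = 0 then lam i else Poly_Mapping.lookup (g i) \<beta>)"
    and vH: "v (HCoeff i \<beta>) = (if i \<in> B \<and> \<beta> = 0 then mu i else Poly_Mapping.lookup (h i) \<beta>)"
    for i \<beta>
    by (simp_all add: v_def)
  have "kkt_coeffs n m a0 b0 a b A B t v = coeff_of F g h t"
    if t: "t \<in> coeff_indices n m l1 l2 a0 b0 a b" for t
  proof (cases t)
    case (FCoeff \<alpha>)
    show ?thesis
    proof (cases "\<alpha> \<in> linear_mons n m")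
      case True
      then obtain q where q: "q \<in> Inl ` {..<n} \<union> Inr ` {..<m}" and \<alpha>: "\<alpha> = Poly_Mapping.single q 1"
        by (auto simp: linear_mons_def)
      have "(case q of
          Inl k \<Rightarrow> lagrange_sum n a A (\<lambda>i \<beta>. v (GCoeff i \<beta>)) (\<lambda>k. point_of v (Inl k)) k
        | Inr k \<Rightarrow> lagrange_sum m b B (\<lambda>j \<beta>. v (HCoeff j \<beta>)) (\<lambda>k. point_of v (Inr k)) k)
        = peval (pdiff q F) (case_sum X Y)"
      proof (cases q)
        case (Inl k)
        have "lagrange_sum n a A (\<lambda>i \<beta>. v (GCoeff i \<beta>)) (\<lambda>k. point_of v (Inl k)) k
            = (\<Sum>i\<in>A. lam i * peval (pdiff k (g i)) X)"
          by (rule lagrange_sum_eq) (auto simp: gi pt vG A_def)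
        then show ?thesis using dx[of k] q Inl by auto
      next
        case (Inr k)
        have "lagrange_sum m b B (\<lambda>j \<beta>. v (HCoeff j \<beta>)) (\<lambda>k. point_of v (Inr k)) k
            = (\<Sum>j\<in>B. mu j * peval (pdiff k (h j)) Y)"
          by (rule lagrange_sum_eq) (auto simp: hj pt' vH B_def)
        then show ?thesis using dy[of k] q Inr by auto
      qed
      moreover have "the_elem (Poly_Mapping.keys \<alpha>) = q" by (simp add: \<alpha>)
      \<comment> \<open>The Lagrange sum equals the derivative of \<open>F\<close>; subtracting all
        its terms except the pivot leaves the linear coefficient.\<close>
      ultimately show ?thesis
        using linear_coeff_eq[OF pos F q v_def] True by (simp add: FCoeff Let_def \<alpha>)
    next
      case False
      then show ?thesis by (simp add: FCoeff v_def)
    qed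
  next
    case (GCoeff i \<alpha>)
    show ?thesis
    proof (cases "i \<in> A \<and> \<alpha> = 0")
      case True
      have "nonconst_part n (a i) (\<lambda>\<beta>. v (GCoeff i \<beta>)) (\<lambda>k. point_of v (Inl k))
          = peval (g i) X - Poly_Mapping.lookup (g i) 0"
        using True by (intro nonconst_part_eq gi pt) (auto simp: A_def vG)
      then show ?thesis using True by (simp add: GCoeff A_def)
    qed (auto simp: GCoeff vG)
  next
    case (HCoeff j \<alpha>)
    show ?thesis
    proof (cases "j \<in> B \<and> \<alpha> = 0")
      case True
      have "nonconst_part m (b j) (\<lambda>\<beta>. v (HCoeff j \<beta>)) (\<lambda>k. point_of v (Inr k))
          = peval (h j) Y - Poly_Mapping.lookup (h j) 0"
        using True by (intro nonconst_part_eq hj pt') (auto simp: B_def vH)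
      then show ?thesis using True by (simp add: HCoeff B_def)
    qed (auto simp: HCoeff vH)
  qed
  moreover have "A \<subseteq> {..<l1}" "B \<subseteq> {..<l2}" by (auto simp: A_def B_def)
  ultimately show ?thesis
    using pt pt' unfolding X_def Y_def by blast
qed

section \<open>Finiteness of the solution set\<close>

lemma finite_vecs:
  assumes "\<And>k. k < n \<Longrightarrow> finite (R k)"
  shows "finite {x \<in> carrier_vec n. \<forall>k<n. x $ k \<in> R k}"
proof (rule finite_subset)
  show "{x \<in> carrier_vec n. \<forall>k<n. x $ k \<in> R k} \<subseteq> vec n ` (\<Pi>\<^sub>E k\<in>{..<n}. R k)"
  proof
    fix x assume x: "x \<in> {x \<in> carrier_vec n. \<forall>k<n. x $ k \<in> R k}"
    then have "x = vec n (\<lambda>k\<in>{..<n}. x $ k)" by (intro eq_vecI) auto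
    moreover have "(\<lambda>k\<in>{..<n}. x $ k) \<in> (\<Pi>\<^sub>E k\<in>{..<n}. R k)" using x by auto
    ultimately show "x \<in> vec n ` (\<Pi>\<^sub>E k\<in>{..<n}. R k)" by blast
  qed
  show "finite (vec n ` (\<Pi>\<^sub>E k\<in>{..<n}. R k))"
    using assms by (intro finite_imageI finite_PiE) auto
qed

theorem theorem3p3:
  fixes n m l1 l2 a0 b0 :: nat
    and a b :: "nat \<Rightarrow> nat"
    and EX1 EX2 EY1 EY2 :: "nat set"
    and G1 H1 :: "(nat \<Rightarrow> nat mpoly) \<Rightarrow> nat mpoly mat"
  assumes "EX1 \<union> EX2 = {..<l1}" "EX1 \<inter> EX2 = {}"
    and "EY1 \<union> EY2 = {..<l2}" "EY1 \<inter> EY2 = {}"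
    and "0 < a0" "0 < b0"
    and "\<And>i. i < l1 \<Longrightarrow> 0 < a i" "\<And>j. j < l2 \<Longrightarrow> 0 < b j"
    and "\<And>g. g \<in> poly_tuples n l1 a \<Longrightarrow> nonsingular_tuple n l1 g \<Longrightarrow> poly_left_inverse n l1 g (G1 g)"
    and "\<And>h. h \<in> poly_tuples m l2 b \<Longrightarrow> nonsingular_tuple m l2 h \<Longrightarrow> poly_left_inverse m l2 h (H1 h)"
  shows "generically n m l1 l2 a0 b0 a b
    (\<lambda>F g h. finite (kkt_solutions n m EX1 EX2 EY1 EY2 (G1 g) (H1 h) F g h))"
proof -
  let ?I = "coeff_indices n m l1 l2 a0 b0 a b"
  let ?M = "Pi\<^sub>M ?I (\<lambda>_. lborel :: complex measure)"
  let ?Q = "Inl ` {..<n} \<union> Inr ` {..<m}"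
  let ?T = "Pow {..<l1} \<times> Pow {..<l2} \<times> ?Q"
  \<comment> \<open>All values that coordinate \<open>q\<close> takes on the fibre over
    \<open>c\<close> for the active sets \<open>A\<close> and \<open>B\<close>; these include its
    values at the solutions with these active sets.\<close>
  define R where "R = (\<lambda>c (A, B, q).
    {point_of v q |v. \<forall>t\<in>?I. kkt_coeffs n m a0 b0 a b A B t v = c t})"
  have "\<forall>s\<in>?T. \<exists>N. N \<in> null_sets ?M \<and> (\<forall>c. restrict c ?I \<notin> N \<longrightarrow> finite (R c s))"
  proof
    fix s assume "s \<in> ?T"
    then obtain A B q where s: "s = (A, B, q)" "A \<subseteq> {..<l1}" "B \<subseteq> {..<l2}" "q \<in> ?Q" by blast
    have "\<exists>d. \<forall>t\<in>?I. poly_fun_le ?I d (kkt_coeffs n m a0 b0 a b A B t)"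
      by (rule poly_fun_uniform_bound[OF finite_coeff_indices poly_fun_kkt_coeffs[OF assms(5,6) s(2,3)]])
    then obtain d where "\<forall>t\<in>?I. poly_fun_le ?I d (kkt_coeffs n m a0 b0 a b A B t)" ..
    moreover obtain e where "poly_fun_le ?I e (\<lambda>v. point_of v q)"
      using poly_fun_point_of[OF assms(5,6) s(4)] unfolding poly_fun_def by blast
    ultimately have "t \<in> ?I \<Longrightarrow> poly_fun_le ?I (max d e) (kkt_coeffs n m a0 b0 a b A B t)"
      and "poly_fun_le ?I (max d e) (\<lambda>v. point_of v q)" for t
      by (auto intro: poly_fun_le_mono)
    \<comment> \<open>Labels of the \<open>g\<close> constraints stay below \<open>l1\<close>, so
      this index is free to name the coordinate polynomial in
      \<open>finite_fibre_values\<close>.\<close>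
    moreover have "GCoeff l1 0 \<notin> ?I" by (auto simp: coeff_indices_def)
    ultimately show "\<exists>N. N \<in> null_sets ?M \<and> (\<forall>c. restrict c ?I \<notin> N \<longrightarrow> finite (R c s))"
      using finite_fibre_values[OF finite_coeff_indices, of "GCoeff l1 0" n m l1 l2 a0 b0 a b
          "max d e" "kkt_coeffs n m a0 b0 a b A B" "\<lambda>v. point_of v q"]
      unfolding R_def s by auto
  qed
  from bchoice[OF this] obtain N
    where N: "\<forall>s\<in>?T. N s \<in> null_sets ?M \<and> (\<forall>c. restrict c ?I \<notin> N s \<longrightarrow> finite (R c s))" ..
  \<comment> \<open>There are finitely many choices of active sets and coordinate, so one null set
    serves them all.\<close>
  have "(\<Union>s\<in>?T. N s) \<in> null_sets ?M"
    using bspec[OF N] by (intro null_sets.finite_UN) simp_all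
  moreover have "finite (kkt_solutions n m EX1 EX2 EY1 EY2 (G1 g) (H1 h) F g h)"
    if F: "F \<in> polys2 n m a0 b0" and g: "g \<in> poly_tuples n l1 a" and h: "h \<in> poly_tuples m l2 b"
      and notin: "restrict (coeff_of F g h) ?I \<notin> (\<Union>s\<in>?T. N s)" for F g h
  proof (rule finite_subset)
    let ?c = "coeff_of F g h"
    \<comment> \<open>For fixed active sets the solutions lie in a finite grid of possible
      coordinate values.\<close>
    let ?S = "\<lambda>A B. {x \<in> carrier_vec n. \<forall>k<n. x $ k \<in> R ?c (A, B, Inl k)} \<times>
        {y \<in> carrier_vec m. \<forall>k<m. y $ k \<in> R ?c (A, B, Inr k)}"
    show "kkt_solutions n m EX1 EX2 EY1 EY2 (G1 g) (H1 h) F g h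
        \<subseteq> (\<Union>A\<in>Pow {..<l1}. \<Union>B\<in>Pow {..<l2}. ?S A B)"
    proof
      fix p assume p: "p \<in> kkt_solutions n m EX1 EX2 EY1 EY2 (G1 g) (H1 h) F g h"
      obtain x y where xy: "p = (x, y)" by (cases p)
      obtain A B v where AB: "A \<subseteq> {..<l1}" "B \<subseteq> {..<l2}"
        and v: "\<forall>t\<in>?I. kkt_coeffs n m a0 b0 a b A B t v = ?c t"
        and x: "\<forall>k<n. point_of v (Inl k) = x $ k" and y: "\<forall>k<m. point_of v (Inr k) = y $ k"
        using kkt_solution_coeffs[OF assms(1,3,5,6) F g h p[unfolded xy]] by blast
      have R: "point_of v q \<in> R ?c (A, B, q)" for q
        using v by (auto simp: R_def)
      have "x $ k \<in> R ?c (A, B, Inl k)" if "k < n" for k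
        using R[of "Inl k"] x that by simp
      moreover have "y $ k \<in> R ?c (A, B, Inr k)" if "k < m" for k
        using R[of "Inr k"] y that by simp
      moreover have "x \<in> carrier_vec n" "y \<in> carrier_vec m"
        using p xy by (auto simp: kkt_solutions_def)
      ultimately have "p \<in> ?S A B" unfolding xy by simp
      with AB show "p \<in> (\<Union>A\<in>Pow {..<l1}. \<Union>B\<in>Pow {..<l2}. ?S A B)" by blast
    qed
    have "finite (R ?c s)" if "s \<in> ?T" for s
      using bspec[OF N that] notin that by blast
    then show "finite (\<Union>A\<in>Pow {..<l1}. \<Union>B\<in>Pow {..<l2}. ?S A B)"
      by (intro finite_UN_I finite_cartesian_product finite_vecs) auto
  qed
  ultimately show ?thesis unfolding generically_def Let_def by blast
qed

end
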